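(* Let $\mathfrak{g}$ be a product by generators. Then $\dim Z(\mathfrak{g})\ge 6$ and $\dim \mathfrak{g}/C^1\mathfrak{g}\ge 4$. In particular, no filiform Lie algebra is a product by generators.
   Context: All Lie algebras are finite-dimensional, complex, nilpotent and nonabelian (in particular the one-dimensional algebra is excluded). $C^1\mathfrak{g}=[\mathfrak{g},\mathfrak{g}]$, $C^{k+1}\mathfrak{g}=[\mathfrak{g},C^k\mathfrak{g}]$, $Z(\mathfrak{g})$ is the center. Product by generators of two algebras $\mathfrak{g}_1,\mathfrak{g}_2$: take bases $\{X_1,\dots,X_{m_1}\}$, $\{X'_1,\dots,X'_{m_2}\}$ such that $X_1,\dots,X_{n_1}$ generate $\mathfrak{g}_1$ and $X_{n_1+1},\dots,X_{m_1}$ span $C^1\mathfrak{g}_1$, and similarly for $\mathfrak{g}_2$ with $n_2$ generators; $\mathfrak{g}_1\underline{\times}\mathfrak{g}_2$ is the Lie algebra on $\mathfrak{g}_1\oplus\mathfrak{g}_2\oplus\langle Z_1,\dots,Z_{n_1n_2}\rangle$ with the brackets of $\mathfrak{g}_1$ and of $\mathfrak{g}_2$, $[X_i,X'_j]=Z_{(i-1)n_2+j}$ for $i\le n_1$, $j\le n_2$, $[X_i,X'_j]=0$ otherwise, and the $Z_k$ central. A nilpotent Lie algebra $\mathfrak{g}$ is called a product by generators if there exist (nonabelian) subalgebras $\mathfrak{h}_1,\mathfrak{h}_2$ with $\mathfrak{g}\cong\mathfrak{h}_1\underline{\times}\mathfrak{h}_2$. A nilpotent Lie algebra of dimension $n$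 is filiform if $\dim C^k\mathfrak{g}=n-k-1$ for $1\le k\le n-1$ (maximal nilindex). *)

theory Defs
  imports "HOL-Analysis.Analysis"
begin

text \<open>A finite-dimensional complex Lie algebra is modelled as the complex vector
space complex^'n (complex scalar multiplication (*s), linear algebra via the
interpretation vec of Cartesian_Space) together with a bracket br.
Every finite-dimensional complex Lie algebra of positive dimension is isomorphic
to one of this form.\<close>

type_synonym 'n lie_bracket = "complex^'n \<Rightarrow> complex^'n \<Rightarrow> complex^'n"

definition lie_algebra :: "('n::finite) lie_bracket \<Rightarrow> bool" where
  "lie_algebra br \<longleftrightarrow>
     (\<forall>x. Vector_Spaces.linear (*s) (*s) (br x)) \<and>
     (\<forall>y. Vector_Spaces.linear (*s) (*s) (\<lambda>x. br x y)) \<and>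
     (\<forall>x. br x x = 0) \<and>
     (\<forall>x y z. br x (br y z) + br y (br z x) + br z (br x y) = 0)"

text \<open>[A,B]: the linear span of all brackets.\<close>
definition lie_brs :: "('n::finite) lie_bracket \<Rightarrow> (complex^'n) set \<Rightarrow> (complex^'n) set \<Rightarrow> (complex^'n) set" where
  "lie_brs br A B = vec.span {br a b | a b. a \<in> A \<and> b \<in> B}"

text \<open>Lower central series: lcs br 0 = g, lcs br (k+1) = [g, lcs br k]; so lcs br k = C^k g.\<close>
fun lcs :: "('n::finite) lie_bracket \<Rightarrow> nat \<Rightarrow> (complex^'n) set" where
  "lcs br 0 = UNIV"
| "lcs br (Suc k) = lie_brs br UNIV (lcs br k)"

definition lie_nilpotent :: "('n::finite) lie_bracket \<Rightarrow> bool" where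
  "lie_nilpotent br \<longleftrightarrow> (\<exists>k. lcs br k = {0})"

definition lie_nonabelian :: "('n::finite) lie_bracket \<Rightarrow> (complex^'n) set \<Rightarrow> bool" where
  "lie_nonabelian br A \<longleftrightarrow> (\<exists>a\<in>A. \<exists>b\<in>A. br a b \<noteq> 0)"

definition lie_center :: "('n::finite) lie_bracket \<Rightarrow> (complex^'n) set" where
  "lie_center br = {z. \<forall>x. br z x = 0}"

definition lie_subalgebra :: "('n::finite) lie_bracket \<Rightarrow> (complex^'n) set \<Rightarrow> bool" where
  "lie_subalgebra br A \<longleftrightarrow> vec.subspace A \<and> (\<forall>a\<in>A. \<forall>b\<in>A. br a b \<in> A)"

text \<open>Lie subalgebra generated by a set S.\<close>
definition lie_generated :: "('n::finite) lie_bracket \<Rightarrow> (complex^'n) set \<Rightarrow> (complex^'n) set" where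
  "lie_generated br S = \<Inter>{A. lie_subalgebra br A \<and> S \<subseteq> A}"

text \<open>Adapted basis of a subalgebra A: the list X is a basis of A, its first n elements
generate A as a Lie algebra, and the remaining ones span C^1 A = [A,A].\<close>
definition adapted_basis :: "('n::finite) lie_bracket \<Rightarrow> (complex^'n) set \<Rightarrow> (complex^'n) list \<Rightarrow> nat \<Rightarrow> bool" where
  "adapted_basis br A X n \<longleftrightarrow>
     distinct X \<and> vec.independent (set X) \<and> vec.span (set X) = A \<and> n \<le> length X \<and>
     lie_generated br (set (take n X)) = A \<and> vec.span (set (drop n X)) = lie_brs br A A"

text \<open>g is a product by generators: g is isomorphic to h1 x_ h2 for nonabelian
subalgebras h1, h2.  Written through the image of the isomorphism: g has a basis
X @ Y @ Z where X (resp. Y) is an adapted basis of a nonabelian subalgebra A (resp. B)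
with n1 (resp. n2) generators, Z_{i n2 + j} = [X_i, Y_j] for i < n1, j < n2,
[X_i, Y_j] = 0 otherwise, and the Z_k are central.  (Indices are 0-based.)\<close>
definition product_by_generators :: "('n::finite) lie_bracket \<Rightarrow> bool" where
  "product_by_generators br \<longleftrightarrow>
     (\<exists>A B X Y n1 n2 Zs.
        lie_subalgebra br A \<and> lie_subalgebra br B \<and>
        lie_nonabelian br A \<and> lie_nonabelian br B \<and>
        adapted_basis br A X n1 \<and> adapted_basis br B Y n2 \<and>
        length Zs = n1 * n2 \<and>
        (\<forall>i<n1. \<forall>j<n2. Zs ! (i * n2 + j) = br (X ! i) (Y ! j)) \<and>
        (\<forall>i<length X. \<forall>j<length Y. (n1 \<le> i \<or> n2 \<le> j) \<longrightarrow> br (X ! i) (Y ! j) = 0) \<and>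
        (\<forall>z\<in>set Zs. \<forall>x. br z x = 0) \<and>
        distinct (X @ Y @ Zs) \<and> vec.independent (set (X @ Y @ Zs)) \<and>
        vec.span (set (X @ Y @ Zs)) = UNIV)"

definition filiform :: "('n::finite) lie_bracket \<Rightarrow> bool" where
  "filiform br \<longleftrightarrow>
     (\<forall>k. 1 \<le> k \<and> k \<le> vec.dim (UNIV :: (complex^'n) set) - 1 \<longrightarrow>
        vec.dim (lcs br k) = vec.dim (UNIV :: (complex^'n) set) - k - 1)"

end

theory Submission
  imports Defs
begin

(* Write g = A + B + span Z with the adapted bases X, Y and the central vectors
   Z_{ij} = [X_i, Y_j]. An algebra generated by one element is abelian, so both factors
   need n1, n2 >= 2 generators. Since [X, Y] lies in span Z, C^1 g lies in
   C^1 A + C^1 B + span Z, whose codimension is n1 + n2 >= 4.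
   For the centre, the Z_{ij} give n1 n2 >= 4 central vectors. By nilpotency of g, C^1 A
   contains some c <> 0 with [A, c] = 0; as C^1 A is spanned by the non-generators X_i
   (i >= n1), which commute with Y, c is central in g. Likewise for some d in C^1 B. The
   vectors c, d, Z live in disjoint parts of the basis, hence dim Z(g) >= n1 n2 + 2 >= 6.
   A filiform algebra has dim g/C^1 g = 2, so it cannot be a product by generators. *)

lemma in_set_drop_conv_nth:
  "x \<in> set (drop n xs) \<Longrightarrow> \<exists>i. n \<le> i \<and> i < length xs \<and> xs ! i = x"
  by (auto simp: in_set_conv_nth) (metis add.commute le_add2 less_diff_conv)

lemma (in vector_space) span_Int_span_eq_zero:
  assumes "independent S" "T \<subseteq> S" "U \<subseteq> S" "T \<inter> U = {}"
  shows "span T \<inter> span U = {0}"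
proof -
  interpret vector_space_pair scale scale ..
  obtain g where g: "Vector_Spaces.linear scale scale g" "\<forall>y\<in>S. g y = (if y \<in> T then y else 0)"
    using linear_independent_extend[where f = "\<lambda>y. if y \<in> T then y else 0", OF assms(1)] by blast
  have "x = 0" if x: "x \<in> span T" "x \<in> span U" for x
  proof -
    have "g x = x"
      using linear_eq_on_span[OF g(1) linear_id _ x(1)] g(2) assms(2) by (metis id_apply subsetD)
    moreover have "g x = 0"
      using linear_eq_0_on_span[OF g(1) _ x(2)] g(2) assms(3,4) by (metis disjoint_iff subsetD)
    ultimately show ?thesis by simp
  qed
  then show ?thesis using span_zero by blast
qed

lemma lie_brs_subset_subalgebra: "lie_subalgebra br A \<Longrightarrow> lie_brs br A A \<subseteq> A"
  unfolding lie_brs_def lie_subalgebra_def by (intro vec.span_minimal) auto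

lemma lie_generated_subset: "lie_subalgebra br C \<Longrightarrow> S \<subseteq> C \<Longrightarrow> lie_generated br S \<subseteq> C"
  unfolding lie_generated_def by blast

context
  fixes br :: "('n::finite) lie_bracket"
  assumes lie: "lie_algebra br"
begin

lemma linear_bracket_right: "Vector_Spaces.linear (*s) (*s) (br x)"
  using lie unfolding lie_algebra_def by blast

lemma linear_bracket_left: "Vector_Spaces.linear (*s) (*s) (\<lambda>x. br x y)"
  using lie unfolding lie_algebra_def by blast

lemma bracket_self: "br x x = 0"
  using lie unfolding lie_algebra_def by blast

lemma bracket_antisym: "br x y = - br y x"
proof -
  have "br x y + br y x = br (x + y) (x + y)"
    by (simp add: vec.linear_add[OF linear_bracket_left] vec.linear_add[OF linear_bracket_right]
        bracket_self[of x] bracket_self[of y])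
  also have "\<dots> = 0" by (rule bracket_self)
  finally show ?thesis by (simp add: eq_neg_iff_add_eq_0)
qed

lemma bracket_span_in_subspace:
  assumes W: "vec.subspace W" and B: "\<And>b b'. b \<in> B \<Longrightarrow> b' \<in> B \<Longrightarrow> br b b' \<in> W"
    and u: "u \<in> vec.span B" and v: "v \<in> vec.span B"
  shows "br u v \<in> W"
proof -
  have "vec.span B \<subseteq> br b -` W" if "b \<in> B" for b
    using B that by (intro vec.span_minimal vec.linear_subspace_vimage[OF linear_bracket_right W]) auto
  then have "vec.span B \<subseteq> (\<lambda>x. br x v) -` W"
    using v by (intro vec.span_minimal vec.linear_subspace_vimage[OF linear_bracket_left W]) auto
  then show ?thesis using u by auto
qed

lemma bracket_span_singleton: "u \<in> vec.span {x} \<Longrightarrow> v \<in> vec.span {x} \<Longrightarrow> br u v = 0"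
  using bracket_span_in_subspace[of "{0}" "{x}" u v] by (simp add: bracket_self)

lemma lie_subalgebra_span_singleton: "lie_subalgebra br (vec.span {x})"
  unfolding lie_subalgebra_def by (auto simp: bracket_span_singleton vec.span_zero)

lemma adapted_basis_two_le_generators:
  assumes "lie_nonabelian br A" and "adapted_basis br A X n"
  shows "2 \<le> n"
proof (rule ccontr)
  assume "\<not> 2 \<le> n"
  then have "set (take n X) \<subseteq> vec.span {hd X}"
    using set_take_subset_set_take[of n 1 X] by (cases X) (auto intro: vec.span_base)
  then have "A \<subseteq> vec.span {hd X}"
    using assms(2) lie_generated_subset[OF lie_subalgebra_span_singleton]
    unfolding adapted_basis_def by blast
  then show False
    using assms(1) bracket_span_singleton unfolding lie_nonabelian_def by blast
qed

lemma lie_centerI_spanning: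
  assumes "vec.span S = UNIV" and "\<And>b. b \<in> S \<Longrightarrow> br b c = 0"
  shows "c \<in> lie_center br"
proof -
  have "br c x = 0" for x
  proof (rule vec.linear_eq_0_on_span[OF linear_bracket_right])
    show "x \<in> vec.span S" using assms(1) by simp
    show "br c b = 0" if "b \<in> S" for b using assms(2)[OF that] bracket_antisym[of c b] by simp
  qed
  then show ?thesis unfolding lie_center_def by simp
qed

lemma nilpotent_derived_meets_centralizer:
  assumes nil: "lie_nilpotent br" and sub: "lie_subalgebra br A" and nonab: "lie_nonabelian br A"
  obtains c where "c \<noteq> 0" "c \<in> lie_brs br A A" "\<forall>a\<in>A. br a c = 0"
proof -
  define trivial where "trivial m \<longleftrightarrow> lie_brs br A A \<inter> lcs br m \<subseteq> {0}" for m
  obtain m where "lcs br m = {0}" using nil unfolding lie_nilpotent_def by blast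
  then have "trivial m" unfolding trivial_def by blast
  moreover have "\<not> trivial 0"
    using nonab unfolding trivial_def lie_nonabelian_def lie_brs_def by (auto intro: vec.span_base)
  ultimately obtain k where k: "\<not> trivial k" "trivial (Suc k)"
    using ex_least_nat_less[of trivial m] by blast
  then obtain c where c: "c \<noteq> 0" "c \<in> lie_brs br A A" "c \<in> lcs br k"
    unfolding trivial_def by blast
  have "br a c = 0" if "a \<in> A" for a
  proof -
    have "br a c \<in> lie_brs br A A"
      using that c(2) lie_brs_subset_subalgebra[OF sub] unfolding lie_brs_def
      by (blast intro: vec.span_base)
    moreover have "br a c \<in> lcs br (Suc k)" using c(3) by (auto simp: lie_brs_def intro!: vec.span_base)
    ultimately show ?thesis using k(2) unfolding trivial_def by blast
  qed
  then show ?thesis using that c(1,2) by blast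
qed

lemma nilpotent_derived_meets_center:
  assumes "lie_nilpotent br" and "lie_subalgebra br A" and "lie_nonabelian br A"
    and "vec.span S = UNIV"
    and "\<And>b y. b \<in> S \<Longrightarrow> b \<notin> A \<Longrightarrow> y \<in> lie_brs br A A \<Longrightarrow> br b y = 0"
  obtains c where "c \<noteq> 0" "c \<in> lie_brs br A A" "c \<in> lie_center br"
proof -
  obtain c where c: "c \<noteq> 0" "c \<in> lie_brs br A A" "\<forall>a\<in>A. br a c = 0"
    using nilpotent_derived_meets_centralizer assms(1-3) by blast
  have "c \<in> lie_center br"
    using assms(4,5) c(2,3) by (intro lie_centerI_spanning) blast+
  then show ?thesis using that c(1,2) by blast
qed

end

locale product_by_generators_decomposition =
  fixes br :: "('n::finite) lie_bracket" and A B :: "(complex^'n) set"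
    and X Y Zs :: "(complex^'n) list" and n1 n2 :: nat
  assumes lie: "lie_algebra br"
    and sub_A: "lie_subalgebra br A" and sub_B: "lie_subalgebra br B"
    and nonab_A: "lie_nonabelian br A" and nonab_B: "lie_nonabelian br B"
    and adapted_X: "adapted_basis br A X n1" and adapted_Y: "adapted_basis br B Y n2"
    and length_Zs: "length Zs = n1 * n2"
    and Zs_bracket: "\<forall>i<n1. \<forall>j<n2. Zs ! (i * n2 + j) = br (X ! i) (Y ! j)"
    and bracket_X_Y_zero:
      "\<forall>i<length X. \<forall>j<length Y. (n1 \<le> i \<or> n2 \<le> j) \<longrightarrow> br (X ! i) (Y ! j) = 0"
    and Zs_commute: "\<forall>z\<in>set Zs. \<forall>x. br z x = 0"
    and distinct_basis: "distinct (X @ Y @ Zs)"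
    and independent_basis: "vec.independent (set (X @ Y @ Zs))"
    and span_basis: "vec.span (set (X @ Y @ Zs)) = UNIV"

lemma product_by_generatorsE:
  assumes "lie_algebra br" and "product_by_generators br"
  obtains A B X Y Zs n1 n2 where "product_by_generators_decomposition br A B X Y Zs n1 n2"
  using assms unfolding product_by_generators_def product_by_generators_decomposition_def
  by blast

context product_by_generators_decomposition
begin

lemma two_le_n1: "2 \<le> n1"
  by (rule adapted_basis_two_le_generators[OF lie nonab_A adapted_X])

lemma two_le_n2: "2 \<le> n2"
  by (rule adapted_basis_two_le_generators[OF lie nonab_B adapted_Y])

lemma set_X_subset: "set X \<subseteq> A"
  using adapted_X vec.span_superset unfolding adapted_basis_def by blast

lemma set_Y_subset: "set Y \<subseteq> B"
  using adapted_Y vec.span_superset unfolding adapted_basis_def by blast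

lemma derived_A_eq: "lie_brs br A A = vec.span (set (drop n1 X))"
  using adapted_X unfolding adapted_basis_def by simp

lemma derived_B_eq: "lie_brs br B B = vec.span (set (drop n2 Y))"
  using adapted_Y unfolding adapted_basis_def by simp

lemma Zs_subset_center: "set Zs \<subseteq> lie_center br"
  using Zs_commute unfolding lie_center_def by blast

lemma bracket_Zs_right: "z \<in> set Zs \<Longrightarrow> br x z = 0"
  using Zs_commute bracket_antisym[OF lie, of x z] by simp

lemma bracket_X_Y:
  assumes "x \<in> set X" and "y \<in> set Y"
  shows "br x y \<in> vec.span (set Zs)"
proof -
  obtain i j where ij: "i < length X" "x = X ! i" "j < length Y" "y = Y ! j"
    using assms by (metis in_set_conv_nth)
  show ?thesis
  proof (cases "i < n1 \<and> j < n2")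
    case True
    then have "i * n2 + j < length Zs"
      using length_Zs mult_le_mono1[of "Suc i" n1 n2] by simp
    then show ?thesis
      using True Zs_bracket ij by (metis nth_mem vec.span_base)
  qed (use bracket_X_Y_zero ij vec.span_zero in auto)
qed

lemma bracket_X_derived_B:
  assumes "x \<in> set X" and "y \<in> lie_brs br B B"
  shows "br x y = 0"
proof (rule vec.linear_eq_0_on_span[OF linear_bracket_right[OF lie]])
  show "y \<in> vec.span (set (drop n2 Y))" using assms(2) derived_B_eq by simp
  fix b assume "b \<in> set (drop n2 Y)"
  then show "br x b = 0"
    using assms(1) bracket_X_Y_zero by (metis in_set_conv_nth in_set_drop_conv_nth)
qed

lemma bracket_derived_A_Y:
  assumes "x \<in> lie_brs br A A" and "y \<in> set Y"
  shows "br x y = 0"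
proof (rule vec.linear_eq_0_on_span[OF linear_bracket_left[OF lie]])
  show "x \<in> vec.span (set (drop n1 X))" using assms(1) derived_A_eq by simp
  fix b assume "b \<in> set (drop n1 X)"
  then show "br b y = 0"
    using assms(2) bracket_X_Y_zero by (metis in_set_conv_nth in_set_drop_conv_nth)
qed

lemma dim_UNIV_eq: "vec.dim (UNIV :: (complex^'n) set) = length X + length Y + length Zs"
proof -
  have "vec.dim (UNIV :: (complex^'n) set) = card (set (X @ Y @ Zs))"
    using vec.dim_span_eq_card_independent[OF independent_basis] unfolding span_basis .
  also have "\<dots> = length X + length Y + length Zs"
    using distinct_card[OF distinct_basis] by simp
  finally show ?thesis .
qed

lemma bracket_basis_in_span:
  assumes "b \<in> set (X @ Y @ Zs)" and "b' \<in> set (X @ Y @ Zs)"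
  shows "br b b' \<in> vec.span (set (drop n1 X) \<union> set (drop n2 Y) \<union> set Zs)"
    (is "_ \<in> ?W")
proof -
  have XX: "br x x' \<in> ?W" if "x \<in> set X" "x' \<in> set X" for x x'
  proof -
    have "br x x' \<in> lie_brs br A A"
      using that set_X_subset unfolding lie_brs_def by (blast intro: vec.span_base)
    then show ?thesis unfolding derived_A_eq by (rule subsetD[OF vec.span_mono, rotated]) blast
  qed
  have YY: "br y y' \<in> ?W" if "y \<in> set Y" "y' \<in> set Y" for y y'
  proof -
    have "br y y' \<in> lie_brs br B B"
      using that set_Y_subset unfolding lie_brs_def by (blast intro: vec.span_base)
    then show ?thesis unfolding derived_B_eq by (rule subsetD[OF vec.span_mono, rotated]) blast
  qed
  have XY: "br x y \<in> ?W" if "x \<in> set X" "y \<in> set Y" for x y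
    using bracket_X_Y[OF that] vec.span_mono[of "set Zs"] by blast
  have YX: "br y x \<in> ?W" if "x \<in> set X" "y \<in> set Y" for x y
    using XY[OF that] bracket_antisym[OF lie, of y x] vec.span_neg by fastforce
  show ?thesis
    using assms XX YY XY YX Zs_commute bracket_Zs_right vec.span_zero by auto
qed

lemma lcs_1_subset: "lcs br 1 \<subseteq> vec.span (set (drop n1 X) \<union> set (drop n2 Y) \<union> set Zs)"
  unfolding One_nat_def lcs.simps lie_brs_def
  by (rule vec.span_minimal)
     (auto intro!: bracket_span_in_subspace[OF lie _ bracket_basis_in_span] simp: span_basis[simplified])

lemma n1_plus_n2_le_codim_derived:
  "n1 + n2 \<le> vec.dim (UNIV :: (complex^'n) set) - vec.dim (lcs br 1)"
proof -
  let ?W = "set (drop n1 X) \<union> set (drop n2 Y) \<union> set Zs"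
  have "vec.dim (lcs br 1) \<le> card ?W"
    using lcs_1_subset by (intro vec.dim_le_card) auto
  also have "\<dots> \<le> length (drop n1 X) + length (drop n2 Y) + length Zs"
    using card_Un_le[of "set (drop n1 X) \<union> set (drop n2 Y)" "set Zs"]
      card_Un_le[of "set (drop n1 X)" "set (drop n2 Y)"]
      card_length[of "drop n1 X"] card_length[of "drop n2 Y"] card_length[of Zs]
    by linarith
  finally have "vec.dim (lcs br 1) \<le> (length X - n1) + (length Y - n2) + length Zs"
    by simp
  moreover have "n1 \<le> length X" "n2 \<le> length Y"
    using adapted_X adapted_Y unfolding adapted_basis_def by simp_all
  ultimately show ?thesis unfolding dim_UNIV_eq by linarith
qed

lemma n1_times_n2_plus_2_le_dim_center:
  assumes nil: "lie_nilpotent br"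
  shows "n1 * n2 + 2 \<le> vec.dim (lie_center br)"
proof -
  obtain c where c: "c \<noteq> 0" "c \<in> lie_brs br A A" "c \<in> lie_center br"
  proof (rule nilpotent_derived_meets_center[OF lie nil sub_A nonab_A span_basis])
    fix b y assume "b \<in> set (X @ Y @ Zs)" "b \<notin> A" "y \<in> lie_brs br A A"
    then show "br b y = 0"
      using set_X_subset bracket_derived_A_Y bracket_antisym[OF lie, of b y] Zs_commute by auto
  qed
  obtain d where d: "d \<noteq> 0" "d \<in> lie_brs br B B" "d \<in> lie_center br"
  proof (rule nilpotent_derived_meets_center[OF lie nil sub_B nonab_B span_basis])
    fix b y assume "b \<in> set (X @ Y @ Zs)" "b \<notin> B" "y \<in> lie_brs br B B"
    then show "br b y = 0"
      using set_Y_subset bracket_X_derived_B Zs_commute by auto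
  qed
  have disjoint: "set (drop n1 X) \<inter> (set (drop n2 Y) \<union> set Zs) = {}"
    "set (drop n2 Y) \<inter> set Zs = {}"
    using distinct_basis by (auto dest: in_set_dropD)
  have d_notin: "d \<notin> vec.span (set Zs)"
    using vec.span_Int_span_eq_zero[OF independent_basis _ _ disjoint(2)] d(1,2)
    unfolding derived_B_eq by (auto dest: in_set_dropD)
  have "vec.span (insert d (set Zs)) \<subseteq> vec.span (set (drop n2 Y) \<union> set Zs)"
    using d(2) unfolding derived_B_eq
    by (intro vec.span_minimal) (auto intro: vec.span_base subsetD[OF vec.span_mono, rotated])
  then have c_notin: "c \<notin> vec.span (insert d (set Zs))"
    using vec.span_Int_span_eq_zero[OF independent_basis _ _ disjoint(1)] c(1,2)
    unfolding derived_A_eq by (auto dest: in_set_dropD)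
  have "vec.independent (insert c (insert d (set Zs)))"
    using vec.independent_mono[OF independent_basis]
    by (intro vec.independent_insertI c_notin d_notin) auto
  then have "card (insert c (insert d (set Zs))) \<le> vec.dim (lie_center br)"
    using c(3) d(3) Zs_subset_center by (intro vec.independent_card_le_dim) auto
  moreover have "card (insert c (insert d (set Zs))) = n1 * n2 + 2"
    using c_notin d_notin vec.span_base distinct_card[of Zs] distinct_basis length_Zs
    by (metis card_insert_disjoint distinct_append finite_insert finite_set add_2_eq_Suc')
  ultimately show ?thesis by simp
qed

end

lemma filiform_codim_derived_le_2:
  fixes br :: "('n::finite) lie_bracket"
  assumes "filiform br"
  shows "vec.dim (UNIV :: (complex^'n) set) - vec.dim (lcs br 1) \<le> 2"
  using assms unfolding filiform_def by (cases "vec.dim (UNIV :: (complex^'n) set) \<le> 1") auto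

theorem mainTheorem6:
  fixes br :: "('n::finite) lie_bracket"
  assumes "lie_algebra br" and "lie_nilpotent br" and "lie_nonabelian br UNIV"
  shows "(product_by_generators br \<longrightarrow>
            vec.dim (lie_center br) \<ge> 6 \<and>
            vec.dim (UNIV :: (complex^'n) set) - vec.dim (lcs br 1) \<ge> 4) \<and>
         (filiform br \<longrightarrow> \<not> product_by_generators br)"
proof -
  have bounds: "vec.dim (lie_center br) \<ge> 6 \<and>
      vec.dim (UNIV :: (complex^'n) set) - vec.dim (lcs br 1) \<ge> 4"
    if pbg: "product_by_generators br"
  proof -
    obtain A B X Y Zs n1 n2 where "product_by_generators_decomposition br A B X Y Zs n1 n2"
      using product_by_generatorsE[OF assms(1) pbg] .
    then interpret product_by_generators_decomposition br A B X Y Zs n1 n2 .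
    have "4 \<le> n1 * n2" using mult_le_mono[OF two_le_n1 two_le_n2] by simp
    then show ?thesis
      using n1_times_n2_plus_2_le_dim_center[OF assms(2)] n1_plus_n2_le_codim_derived
        two_le_n1 two_le_n2 by linarith
  qed
  then show ?thesis using filiform_codim_derived_le_2 by fastforce
qed

end
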